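(* Let $\mathbb{F}$ be a field and let $P \in \mathbb{F}[x_1,\ldots,x_n]$ be a homogeneous polynomial such that $\deg(P) < |\mathbb{F}|$ and $\dim(\mathcal{L}_P) + \dim(\operatorname{rad}(P)) = n$. If $\phi, \psi \colon \mathbb{F}^n \to \mathbb{F}^n$ are maps such that $$P(\mathbf{x} + \lambda \mathbf{y}) = P(\phi(\mathbf{x}) + \lambda \psi(\mathbf{y}))\quad\text{for all } \mathbf{x},\mathbf{y} \in \mathbb{F}^n,\ \lambda \in \mathbb{F},$$ then there exists a unique linear map $T_{\operatorname{rad}(P)} \colon \mathbb{F}^n/\operatorname{rad}(P) \to \mathbb{F}^n/\operatorname{rad}(P)$ preserving $P_{\operatorname{rad}(P)}$ such that $$\pi_{\operatorname{rad}(P)} \circ \phi = \pi_{\operatorname{rad}(P)} \circ \psi = T_{\operatorname{rad}(P)} \circ \pi_{\operatorname{rad}(P)}.$$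
   Context: For a polynomial $P \in \mathbb{F}[x_1,\ldots,x_n]$, regarded as a function $\mathbb{F}^n\to\mathbb{F}$, the radical of $P$ is the vector subspace $\operatorname{rad}(P) = \{\mathbf{x} \in \mathbb{F}^n \mid P(\mathbf{a} + \lambda \mathbf{x}) = P(\mathbf{a}) \text{ for all } \mathbf{a} \in \mathbb{F}^n, \lambda \in \mathbb{F}\}$. The map $\pi_{\operatorname{rad}(P)} \colon \mathbb{F}^n \to \mathbb{F}^n/\operatorname{rad}(P)$ is the canonical projection, and $P_{\operatorname{rad}(P)} \colon \mathbb{F}^n/\operatorname{rad}(P) \to \mathbb{F}$ is the unique function such that $P = P_{\operatorname{rad}(P)} \circ \pi_{\operatorname{rad}(P)}$ (it has trivial radical). A map $T$ preserves a function $f$ if $f\circ T = f$. For $\mathbf{a},\mathbf{v}\in\mathbb{F}^n$, the directional derivative $\frac{\partial P}{\partial \mathbf{v}}(\mathbf{a})$ is the coefficient of $t$ in the polynomial $P(\mathbf{a}+t\mathbf{v})\in\mathbb{F}[t]$. For fixed $\mathbf{a}$ the function $l_{P,\mathbf{a}}\colon \mathbf{v}\mapsto \frac{\partial P}{\partial \mathbf{v}}(\mathbf{a})$ is linear, and $\mathcal{L}_P \subseteq (\mathbb{F}^n)^*$ is the linear span of all $l_{P,\mathbf{a}}$, $\mathbf{a}\in\mathbb{F}^n$. If $\mathbb{F}$ is infinite, the condition $\deg(P)<|\mathbb{F}|$ holds automatically. The maps $\phi,\psi$ are not assumed linear or surjective. *)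

theory Defs
  imports
    "HOL-Analysis.Analysis"
    "HOL-Library.Poly_Mapping"
    "HOL-Library.Function_Algebras"
    "HOL-Library.Set_Algebras"
    "HOL-Library.FuncSet"
    "HOL-Computational_Algebra.Polynomial"
begin

section \<open>Polynomials in finitely many variables\<close>

text \<open>
  The variables are indexed by a finite type, so that the number of variables
  is the cardinality of that type; a monomial is its exponent vector.
\<close>

type_synonym ('n, 'a) mpoly = "('n \<Rightarrow>\<^sub>0 nat) \<Rightarrow>\<^sub>0 'a"

text \<open>Substitution of the variables by \<open>x\<close>, with the coefficients mapped along \<open>c\<close>.\<close>

definition mpoly_subst ::
    "('a::zero \<Rightarrow> 'b::comm_semiring_1) \<Rightarrow> ('n::finite \<Rightarrow> 'b) \<Rightarrow> ('n, 'a) mpoly \<Rightarrow> 'b" where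
  "mpoly_subst c x P =
     (\<Sum>m\<in>Poly_Mapping.keys P. c (Poly_Mapping.lookup P m) * (\<Prod>i\<in>UNIV. x i ^ Poly_Mapping.lookup m i))"

definition mpoly_eval :: "('n::finite, 'a::comm_semiring_1) mpoly \<Rightarrow> 'a ^ 'n \<Rightarrow> 'a" where
  "mpoly_eval P a = mpoly_subst (\<lambda>k. k) (\<lambda>i. a $ i) P"

text \<open>The univariate polynomial \<open>P (a + t v)\<close> in the indeterminate \<open>t\<close>.\<close>

definition mpoly_line ::
    "('n::finite, 'a::comm_semiring_1) mpoly \<Rightarrow> 'a ^ 'n \<Rightarrow> 'a ^ 'n \<Rightarrow> 'a poly" where
  "mpoly_line P a v = mpoly_subst (\<lambda>k. [:k:]) (\<lambda>i. [:a $ i, v $ i:]) P"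

definition monom_deg :: "('n::finite \<Rightarrow>\<^sub>0 nat) \<Rightarrow> nat" where
  "monom_deg m = (\<Sum>i\<in>UNIV. Poly_Mapping.lookup m i)"

text \<open>The total degree; the zero polynomial gets degree \<open>0\<close>.\<close>

definition mpoly_deg :: "('n::finite, 'a::zero) mpoly \<Rightarrow> nat" where
  "mpoly_deg P = Max (insert 0 (monom_deg ` Poly_Mapping.keys P))"

definition homogeneous :: "('n::finite, 'a::zero) mpoly \<Rightarrow> bool" where
  "homogeneous P \<longleftrightarrow> (\<exists>d. \<forall>m\<in>Poly_Mapping.keys P. monom_deg m = d)"

section \<open>The radical\<close>

definition rad :: "('n::finite, 'a::field) mpoly \<Rightarrow> ('a ^ 'n) set" where
  "rad P = {x. \<forall>a l. mpoly_eval P (a + l *s x) = mpoly_eval P a}"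

lemma subspace_rad: "vec.subspace (rad P)"
  unfolding vec.subspace_def
proof (intro conjI ballI allI)
  show "0 \<in> rad P" by (simp add: rad_def)
next
  fix x y assume x: "x \<in> rad P" and y: "y \<in> rad P"
  have "mpoly_eval P (a + l *s (x + y)) = mpoly_eval P a" for a l
  proof -
    have "mpoly_eval P ((a + l *s x) + l *s y) = mpoly_eval P (a + l *s x)"
      using y unfolding rad_def by blast
    also have "\<dots> = mpoly_eval P a"
      using x unfolding rad_def by blast
    finally show ?thesis by (simp add: vec.scale_right_distrib add.assoc)
  qed
  then show "x + y \<in> rad P" by (simp add: rad_def)
next
  fix c x assume "x \<in> rad P"
  then show "c *s x \<in> rad P" by (simp add: rad_def)
qed

section \<open>The span of the directional derivatives\<close>

definition dir_deriv :: "('n::finite, 'a::field) mpoly \<Rightarrow> 'a ^ 'n \<Rightarrow> 'a ^ 'n \<Rightarrow> 'a" where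
  "dir_deriv P v a = coeff (mpoly_line P a v) 1"

definition lin_form :: "('n::finite, 'a::field) mpoly \<Rightarrow> 'a ^ 'n \<Rightarrow> ('a ^ 'n \<Rightarrow> 'a)" where
  "lin_form P a = (\<lambda>v. dir_deriv P v a)"

definition fun_scale :: "'a::field \<Rightarrow> ('b \<Rightarrow> 'a) \<Rightarrow> ('b \<Rightarrow> 'a)" where
  "fun_scale c f = (\<lambda>x. c * f x)"

interpretation funs: vector_space "fun_scale :: 'a::field \<Rightarrow> ('b \<Rightarrow> 'a) \<Rightarrow> ('b \<Rightarrow> 'a)"
  by unfold_locales (auto simp: fun_scale_def fun_eq_iff algebra_simps)

text \<open>
  The dual space is a subspace of the space of all functions with values in the field,
  and span and dimension may be computed in that larger space.
\<close>

definition deriv_span :: "('n::finite, 'a::field) mpoly \<Rightarrow> ('a ^ 'n \<Rightarrow> 'a) set" where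
  "deriv_span P = funs.span (range (lin_form P))"

lemma coeff_0_prod: "coeff (\<Prod>i\<in>A. p i) 0 = (\<Prod>i\<in>A. coeff (p i) 0)"
  for p :: "'b \<Rightarrow> 'a::field poly"
  by (induction A rule: infinite_finite_induct) (auto simp: coeff_mult)

lemma coeff_1_mult: "coeff (p * q) 1 = coeff p 0 * coeff q 1 + coeff p 1 * coeff q 0"
  for p q :: "'a::field poly"
  by (simp add: coeff_mult)

lemma coeff_1_power_linear: "coeff ([:a, v:] ^ k) 1 = of_nat k * a ^ (k - 1) * v"
  for a v :: "'a::field"
proof (induction k)
  case (Suc k)
  show ?case
  proof (cases k)
    case 0
    then show ?thesis by simp
  next
    case (Suc j)
    then show ?thesis using Suc.IH
      by (simp only: power_Suc coeff_1_mult coeff_0_power) (simp add: coeff_0_power algebra_simps)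
  qed
qed simp

lemma coeff_1_prod_linear:
  fixes a :: "'n \<Rightarrow> 'a::field"
  assumes "finite A"
  shows "\<exists>g. \<forall>v. coeff (\<Prod>i\<in>A. [:a i, v i:] ^ e i) 1 = (\<Sum>i\<in>A. g i * v i)"
  using assms
proof (induction A rule: finite_induct)
  case (insert j A)
  then obtain g where g: "\<And>v. coeff (\<Prod>i\<in>A. [:a i, v i:] ^ e i) 1 = (\<Sum>i\<in>A. g i * v i)"
    by blast
  let ?h = "\<lambda>i. if i = j then of_nat (e j) * a j ^ (e j - 1) * (\<Prod>i\<in>A. a i ^ e i)
                 else a j ^ e j * g i"
  have "coeff (\<Prod>i\<in>insert j A. [:a i, v i:] ^ e i) 1 = (\<Sum>i\<in>insert j A. ?h i * v i)" for v
  proof -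
    have "(\<Sum>i\<in>A. ?h i * v i) = (\<Sum>i\<in>A. a j ^ e j * (g i * v i))"
      using insert.hyps by (intro sum.cong) (auto simp: mult.assoc)
    moreover have "coeff (\<Prod>i\<in>insert j A. [:a i, v i:] ^ e i) 1 =
        a j ^ e j * (\<Sum>i\<in>A. g i * v i) +
        of_nat (e j) * a j ^ (e j - 1) * v j * (\<Prod>i\<in>A. a i ^ e i)"
      unfolding prod.insert[OF insert.hyps]
      by (rule trans[OF coeff_1_mult], unfold g coeff_1_power_linear)
         (simp add: coeff_0_prod coeff_0_power)
    ultimately show ?thesis
      unfolding sum.insert[OF insert.hyps] by (simp add: sum_distrib_left)
  qed
  then show ?case by (intro exI[of _ ?h] allI)
qed simp

lemma linear_lin_form: "Vector_Spaces.linear (*s) (*) (lin_form P a)"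
proof -
  have "\<forall>m. \<exists>g. \<forall>v. coeff (\<Prod>i\<in>UNIV. [:a $ i, v i:] ^ Poly_Mapping.lookup m i) 1
      = (\<Sum>i\<in>UNIV. g i * v i)"
    using coeff_1_prod_linear[OF finite] by blast
  then obtain g where g: "\<And>m v. coeff (\<Prod>i\<in>UNIV. [:a $ i, v i:] ^ Poly_Mapping.lookup m i) 1
      = (\<Sum>i\<in>UNIV. g m i * v i)"
    by metis
  have "lin_form P a v = (\<Sum>m\<in>Poly_Mapping.keys P. Poly_Mapping.lookup P m * (\<Sum>i\<in>UNIV. g m i * v $ i))" for v
    unfolding lin_form_def dir_deriv_def mpoly_line_def mpoly_subst_def coeff_sum
    by (intro sum.cong refl) (use g in \<open>simp add: coeff_1_mult\<close>)
  then show ?thesis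
    by unfold_locales
       (auto simp: algebra_simps sum.distrib sum_distrib_left)
qed

section \<open>The quotient by a subspace\<close>

definition quot_proj :: "('a::field ^ 'n) set \<Rightarrow> 'a ^ 'n \<Rightarrow> ('a ^ 'n) set" where
  "quot_proj R x = x +o R"

definition quot_carrier :: "('a::field ^ 'n) set \<Rightarrow> ('a ^ 'n) set set" where
  "quot_carrier R = range (quot_proj R)"

text \<open>
  Cosets are added elementwise. Elementwise multiplication by \<open>0\<close> would give \<open>{0}\<close>
  instead of \<open>R\<close>, hence the additional summand in the scalar multiplication.
\<close>

definition quot_scale :: "('a::field ^ 'n) set \<Rightarrow> 'a \<Rightarrow> ('a ^ 'n) set \<Rightarrow> ('a ^ 'n) set" where
  "quot_scale R c A = (\<lambda>x. c *s x) ` A + R"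

lemma quot_proj_eq_iff:
  assumes "vec.subspace R"
  shows "quot_proj R x = quot_proj R y \<longleftrightarrow> x - y \<in> R"
proof
  assume "quot_proj R x = quot_proj R y"
  moreover have "x \<in> quot_proj R x"
    using vec.subspace_0[OF assms] by (force simp: quot_proj_def elt_set_plus_def)
  ultimately show "x - y \<in> R" by (auto simp: quot_proj_def elt_set_plus_def)
next
  assume d: "x - y \<in> R"
  have "y - x \<in> R" using vec.subspace_neg[OF assms d] by simp
  then have "z - x \<in> R \<longleftrightarrow> z - y \<in> R" for z
    using vec.subspace_add[OF assms _ d, of "z - x"] vec.subspace_add[OF assms, of "z - y" "y - x"]
    by auto
  moreover have "z \<in> quot_proj R w \<longleftrightarrow> z - w \<in> R" for z w
    by (force simp: quot_proj_def elt_set_plus_def)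
  ultimately show "quot_proj R x = quot_proj R y" by blast
qed

lemma quot_proj_add:
  assumes "vec.subspace R"
  shows "quot_proj R x + quot_proj R y = quot_proj R (x + y)"
proof -
  have "R + R = R"
  proof
    show "R + R \<subseteq> R"
      using vec.subspace_add[OF assms] by (auto simp: set_plus_def)
    show "R \<subseteq> R + R"
      using vec.subspace_0[OF assms] by (force simp: set_plus_def)
  qed
  then show ?thesis by (simp add: quot_proj_def set_plus_rearrange)
qed

lemma quot_scale_proj:
  assumes "vec.subspace R"
  shows "quot_scale R c (quot_proj R x) = quot_proj R (c *s x)"
proof
  show "quot_scale R c (quot_proj R x) \<subseteq> quot_proj R (c *s x)"
  proof
    fix z assume "z \<in> quot_scale R c (quot_proj R x)"
    then obtain r s where "r \<in> R" "s \<in> R" "z = c *s (x + r) + s"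
      by (auto simp: quot_scale_def quot_proj_def elt_set_plus_def set_plus_def)
    then have "z = c *s x + (c *s r + s)" "c *s r + s \<in> R"
      using assms by (auto simp: vec.scale_right_distrib add.assoc vec.subspace_add vec.subspace_scale)
    then show "z \<in> quot_proj R (c *s x)" by (auto simp: quot_proj_def elt_set_plus_def)
  qed
  show "quot_proj R (c *s x) \<subseteq> quot_scale R c (quot_proj R x)"
  proof
    fix z assume "z \<in> quot_proj R (c *s x)"
    then obtain r where r: "r \<in> R" "z = c *s x + r"
      by (auto simp: quot_proj_def elt_set_plus_def)
    have "x \<in> quot_proj R x"
      unfolding quot_proj_def elt_set_plus_def
      using vec.subspace_0[OF assms] by (intro CollectI bexI[of _ 0]) simp_all
    then show "z \<in> quot_scale R c (quot_proj R x)"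
      unfolding quot_scale_def r(2) by (intro set_plus_intro imageI r(1))
  qed
qed

text \<open>
  Functions on the quotient are taken to be extensional, so that
  equality of functions is equality on the quotient.
\<close>

definition quot_linear :: "('a::field ^ 'n) set \<Rightarrow> (('a ^ 'n) set \<Rightarrow> ('a ^ 'n) set) \<Rightarrow> bool" where
  "quot_linear R T \<longleftrightarrow>
     T \<in> quot_carrier R \<rightarrow>\<^sub>E quot_carrier R \<and>
     (\<forall>A\<in>quot_carrier R. \<forall>B\<in>quot_carrier R. T (A + B) = T A + T B) \<and>
     (\<forall>c. \<forall>A\<in>quot_carrier R. T (quot_scale R c A) = quot_scale R c (T A))"

definition quot_fun :: "('a::field ^ 'n) set \<Rightarrow> ('a ^ 'n \<Rightarrow> 'a) \<Rightarrow> (('a ^ 'n) set \<Rightarrow> 'a)" where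
  "quot_fun R f = (THE g. g \<in> extensional (quot_carrier R) \<and> f = g \<circ> quot_proj R)"

lemma ex1_quot_fun:
  fixes P :: "('n::finite, 'a::field) mpoly"
  shows "\<exists>!g. g \<in> extensional (quot_carrier (rad P)) \<and> mpoly_eval P = g \<circ> quot_proj (rad P)"
proof (rule ex_ex1I)
  have inv: "mpoly_eval P x = mpoly_eval P y" if "quot_proj (rad P) x = quot_proj (rad P) y" for x y
  proof -
    have "x - y \<in> rad P" using that quot_proj_eq_iff[OF subspace_rad] by blast
    then have "mpoly_eval P (y + 1 *s (x - y)) = mpoly_eval P y" unfolding rad_def by blast
    then show ?thesis by simp
  qed
  let ?g = "restrict (\<lambda>A. mpoly_eval P (SOME x. quot_proj (rad P) x = A)) (quot_carrier (rad P))"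
  have "mpoly_eval P x = ?g (quot_proj (rad P) x)" for x
  proof -
    have "quot_proj (rad P) (SOME y. quot_proj (rad P) y = quot_proj (rad P) x) = quot_proj (rad P) x"
      by (rule someI) (rule refl)
    from inv[OF this] show ?thesis by (simp add: quot_carrier_def)
  qed
  then show "\<exists>g. g \<in> extensional (quot_carrier (rad P)) \<and> mpoly_eval P = g \<circ> quot_proj (rad P)"
    by (intro exI[of _ ?g]) (simp add: fun_eq_iff)
next
  fix g h
  assume "g \<in> extensional (quot_carrier (rad P)) \<and> mpoly_eval P = g \<circ> quot_proj (rad P)"
    and "h \<in> extensional (quot_carrier (rad P)) \<and> mpoly_eval P = h \<circ> quot_proj (rad P)"
  then show "g = h"
    by (intro extensionalityI[of _ "quot_carrier (rad P)"]) (auto simp: quot_carrier_def fun_eq_iff)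
qed

end

theory Submission
  imports Defs
begin

text \<open>
  Since the degree is smaller than the size of the field, the identity
  \<open>P (x + t y) = P (\<phi> x + t (\<psi> y))\<close> is an identity of polynomials in \<open>t\<close>. Its linear
  coefficient says that the gradient at \<open>\<phi> x\<close> takes on \<open>\<psi> y\<close> the value that the gradient
  at \<open>x\<close> takes on \<open>y\<close>. A maximal independent set of gradients at points \<open>x\<close> therefore stays
  independent when each \<open>x\<close> is replaced by \<open>\<phi> x\<close>, so the gradients at the points \<open>\<phi> x\<close>
  span all gradients. By the dimension hypothesis the radical is the common kernel of the
  gradients, and hence \<open>\<psi>\<close> is well defined and linear modulo the radical.
  Homogeneity lets \<open>\<phi>\<close> and \<open>\<psi>\<close> exchange their roles, so that also \<open>P \<circ> \<psi> = P\<close> and the gradients at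
  the points \<open>\<psi> x\<close> span. As \<open>\<psi>\<close> is linear and preserves \<open>P\<close>, the gradient at \<open>\<psi> x\<close> takes the
  same value on \<open>\<psi> y\<close> as on \<open>\<phi> y\<close>, namely that of the gradient at \<open>x\<close> on \<open>y\<close>; hence
  \<open>\<phi> y - \<psi> y\<close> lies in the radical.
\<close>

section \<open>Restriction of a polynomial to a line\<close>

text \<open>Bounds replace exact degrees because a factor \<open>[:a, v:]\<close> drops to degree 0
  when \<open>v = 0\<close>; if a bound is strict, both sides vanish.\<close>

lemma coeff_mult_degree_bound:
  fixes p q :: "'a::comm_semiring_1 poly"
  assumes "degree p \<le> m" and "degree q \<le> n"
  shows "coeff (p * q) (m + n) = coeff p m * coeff q n"
proof (cases "degree p = m \<and> degree q = n")
  case True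
  then show ?thesis using coeff_mult_degree_sum[of p q] by auto
next
  case False
  then have "degree p < m \<or> degree q < n" using assms by auto
  then have "coeff p m * coeff q n = 0" by (auto simp: coeff_eq_0)
  moreover have "degree (p * q) < m + n"
    using False assms degree_mult_le[of p q] by linarith
  ultimately show ?thesis by (simp add: coeff_eq_0)
qed

lemma degree_prod_le_sum:
  fixes p :: "'i \<Rightarrow> 'a::comm_semiring_1 poly"
  assumes "\<And>i. i \<in> A \<Longrightarrow> degree (p i) \<le> e i"
  shows "degree (\<Prod>i\<in>A. p i) \<le> (\<Sum>i\<in>A. e i)"
  using assms
proof (induction A rule: infinite_finite_induct)
  case (insert j A)
  then have "degree (p j) \<le> e j" "degree (\<Prod>i\<in>A. p i) \<le> (\<Sum>i\<in>A. e i)" by simp_all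
  then show ?case
    unfolding prod.insert[OF insert.hyps] sum.insert[OF insert.hyps]
    by (intro order_trans[OF degree_mult_le] add_mono)
qed auto

lemma coeff_prod_degree_bound:
  fixes p :: "'i \<Rightarrow> 'a::comm_semiring_1 poly"
  assumes "\<And>i. i \<in> A \<Longrightarrow> degree (p i) \<le> e i"
  shows "coeff (\<Prod>i\<in>A. p i) (\<Sum>i\<in>A. e i) = (\<Prod>i\<in>A. coeff (p i) (e i))"
  using assms
proof (induction A rule: infinite_finite_induct)
  case (insert j A)
  then show ?case
    by (simp add: coeff_mult_degree_bound degree_prod_le_sum)
qed auto

lemma degree_power_linear_le: "degree ([:a, v:] ^ k) \<le> k"
  by (rule order_trans[OF degree_power_le]) simp

lemma coeff_power_linear: "coeff ([:a, v:] ^ k) k = v ^ k"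
  for a v :: "'a::comm_semiring_1"
proof (induction k)
  case (Suc k)
  have "coeff ([:a, v:] * [:a, v:] ^ k) (1 + k) = coeff [:a, v:] 1 * coeff ([:a, v:] ^ k) k"
    by (rule coeff_mult_degree_bound) (simp_all add: degree_power_linear_le)
  then show ?case using Suc by simp
qed simp

lemma poly_mpoly_line:
  "poly (mpoly_line P a v) t = mpoly_eval P (a + t *s v)"
  by (simp add: mpoly_line_def mpoly_eval_def mpoly_subst_def poly_sum poly_prod algebra_simps)

lemma degree_mpoly_line_monom_le:
  "degree ([:k:] * (\<Prod>i\<in>UNIV. [:a $ i, v $ i:] ^ Poly_Mapping.lookup m i)) \<le> monom_deg m"
  for a v :: "'a::comm_semiring_1 ^ 'n::finite"
proof -
  have "degree [:k:] + degree (\<Prod>i\<in>UNIV. [:a $ i, v $ i:] ^ Poly_Mapping.lookup m i) \<le> 0 + monom_deg m"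
    unfolding monom_deg_def by (intro add_mono degree_prod_le_sum degree_power_linear_le) simp
  then show ?thesis by (intro order_trans[OF degree_mult_le]) simp
qed

lemma degree_mpoly_line_le: "degree (mpoly_line P a v) \<le> mpoly_deg P"
  unfolding mpoly_line_def mpoly_subst_def
proof (rule degree_sum_le)
  fix m assume "m \<in> Poly_Mapping.keys P"
  then have "monom_deg m \<le> mpoly_deg P"
    unfolding mpoly_deg_def by (intro Max_ge) auto
  then show "degree ([:Poly_Mapping.lookup P m:] *
      (\<Prod>i\<in>UNIV. [:a $ i, v $ i:] ^ Poly_Mapping.lookup m i)) \<le> mpoly_deg P"
    by (rule order_trans[OF degree_mpoly_line_monom_le])
qed simp

text \<open>Every monomial has degree \<open>d\<close>, so a power \<open>d\<close> of the
  indeterminate arises only by taking the term with \<open>v $ i\<close> from each linear factor;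
  the base point drops out.\<close>

lemma coeff_mpoly_line_top:
  assumes "\<And>m. m \<in> Poly_Mapping.keys P \<Longrightarrow> monom_deg m = d"
  shows "coeff (mpoly_line P a v) d = mpoly_eval P v"
  unfolding mpoly_line_def mpoly_eval_def mpoly_subst_def coeff_sum
proof (rule sum.cong[OF refl])
  fix m assume "m \<in> Poly_Mapping.keys P"
  then have d: "d = (\<Sum>i\<in>UNIV. Poly_Mapping.lookup m i)" using assms monom_deg_def by metis
  show "coeff ([:Poly_Mapping.lookup P m:] *
      (\<Prod>i\<in>UNIV. [:a $ i, v $ i:] ^ Poly_Mapping.lookup m i)) d =
    Poly_Mapping.lookup P m * (\<Prod>i\<in>UNIV. (v $ i) ^ Poly_Mapping.lookup m i)"
    by (simp add: d coeff_prod_degree_bound degree_power_linear_le coeff_power_linear)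
qed

lemma mpoly_eval_scale:
  assumes "\<And>m. m \<in> Poly_Mapping.keys P \<Longrightarrow> monom_deg m = d"
  shows "mpoly_eval P (c *s x) = c ^ d * mpoly_eval P x"
  unfolding mpoly_eval_def mpoly_subst_def sum_distrib_left
proof (rule sum.cong[OF refl])
  fix m assume "m \<in> Poly_Mapping.keys P"
  then have d: "d = (\<Sum>i\<in>UNIV. Poly_Mapping.lookup m i)" using assms monom_deg_def by metis
  show "Poly_Mapping.lookup P m * (\<Prod>i\<in>UNIV. (c *s x) $ i ^ Poly_Mapping.lookup m i) =
    c ^ d * (Poly_Mapping.lookup P m * (\<Prod>i\<in>UNIV. x $ i ^ Poly_Mapping.lookup m i))"
    by (simp add: d power_mult_distrib prod.distrib power_sum algebra_simps)
qed

text \<open>Both sides have degree at most \<open>mpoly_deg P\<close> and agree at more points than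
  that. The bound on the degree by the size of the field enters the argument through this
  lemma.\<close>

lemma mpoly_line_eqI:
  fixes P :: "('n::finite, 'a::field) mpoly"
  assumes small: "infinite (UNIV :: 'a set) \<or> mpoly_deg P < card (UNIV :: 'a set)"
    and eq: "\<And>t. mpoly_eval P (a + t *s v) = mpoly_eval P (b + t *s w)"
  shows "mpoly_line P a v = mpoly_line P b w"
proof -
  obtain A :: "'a set" where A: "mpoly_deg P < card A"
  proof (cases "infinite (UNIV :: 'a set)")
    case True
    then obtain A :: "'a set" where "card A = Suc (mpoly_deg P)"
      using infinite_arbitrarily_large by blast
    then show ?thesis by (intro that[of A]) simp
  qed (use small that in blast)
  show ?thesis
    by (rule poly_eqI_degree[where A = A])
       (auto simp: poly_mpoly_line eq intro: le_less_trans[OF degree_mpoly_line_le A])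
qed

section \<open>Gradients\<close>

text \<open>Storing the linear form as a vector makes the dimension theory of \<open>'a ^ 'n\<close>
  available for spans of derivatives.\<close>

definition grad :: "('n::finite, 'a::field) mpoly \<Rightarrow> 'a ^ 'n \<Rightarrow> 'a ^ 'n" where
  "grad P a = (\<chi> i. lin_form P a (axis i 1))"

lemma scalar_product_linear [simp]:
  "scalar_product (u + u') v = scalar_product u v + scalar_product u' v"
  "scalar_product (c *s u) v = c * scalar_product u v"
  "scalar_product u (v + v') = scalar_product u v + scalar_product u v'"
  "scalar_product u (c *s v) = c * scalar_product u v"
  "scalar_product 0 v = 0"
  "scalar_product u 0 = 0"
  for u v :: "'a::field ^ 'n"
  by (simp_all add: scalar_product_def algebra_simps sum.distrib sum_distrib_left)

lemma scalar_product_diff_right: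
  "scalar_product u (v - v') = scalar_product u v - scalar_product u v'"
  for u v :: "'a::field ^ 'n"
  by (simp add: scalar_product_def algebra_simps sum_subtractf)

lemma scalar_product_sum_left:
  "scalar_product (\<Sum>b\<in>B. f b) v = (\<Sum>b\<in>B. scalar_product (f b) v)"
  for v :: "'a::field ^ 'n"
  by (induction B rule: infinite_finite_induct) simp_all

lemma scalar_product_commute: "scalar_product u v = scalar_product v u"
  for u v :: "'a::field ^ 'n"
  by (simp add: scalar_product_def mult.commute)

lemma scalar_product_axis [simp]: "scalar_product u (axis i 1) = u $ i"
  for u :: "'a::field ^ 'n"
  by (simp add: scalar_product_def axis_def if_distrib cong: if_cong)

lemma scalar_product_eqI:
  fixes u w :: "'a::field ^ 'n"
  assumes "\<And>v. scalar_product u v = scalar_product w v"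
  shows "u = w"
  using assms[of "axis _ 1"] by (simp add: vec_eq_iff)

lemma scalar_product_span_eq_0:
  fixes v :: "'a::field ^ 'n"
  assumes "w \<in> vec.span W" and "\<And>u. u \<in> W \<Longrightarrow> scalar_product u v = 0"
  shows "scalar_product w v = 0"
  using assms(1) by (induction rule: vec.span_induct_alt) (simp_all add: assms(2))

lemma lin_form_eq: "lin_form P a v = scalar_product (grad P a) v"
proof -
  interpret l: Vector_Spaces.linear "(*s)" "(*)" "lin_form P a" by (rule linear_lin_form)
  have "lin_form P a v = lin_form P a (\<Sum>i\<in>UNIV. v $ i *s axis i 1)"
    by (simp add: basis_expansion)
  also have "\<dots> = scalar_product (grad P a) v"
    unfolding l.sum l.scale by (simp add: scalar_product_def grad_def mult.commute)
  finally show ?thesis .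
qed

lemma scalar_product_grad: "scalar_product (grad P a) v = coeff (mpoly_line P a v) 1"
  using lin_form_eq[of P a v] by (simp add: lin_form_def dir_deriv_def)

lemma dim_deriv_span: "funs.dim (deriv_span P) = vec.dim (range (grad P))"
proof -
  interpret finite_dimensional_vector_space_pair_1 "(*s)" "cart_basis :: ('a ^ 'b) set"
    "fun_scale :: 'a \<Rightarrow> ('a ^ 'b \<Rightarrow> 'a) \<Rightarrow> _" ..
  have "lin_form P a = scalar_product (grad P a)" for a
    by (simp add: fun_eq_iff lin_form_eq)
  then have "range (lin_form P) = scalar_product ` range (grad P)" by auto
  moreover have "Vector_Spaces.linear (*s) fun_scale (scalar_product :: 'a ^ 'b \<Rightarrow> _)"
    by unfold_locales (simp_all add: fun_eq_iff fun_scale_def)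
  moreover have "inj_on (scalar_product :: 'a ^ 'b \<Rightarrow> _) (vec.span (range (grad P)))"
    by (auto intro!: inj_onI scalar_product_eqI)
  ultimately show ?thesis
    unfolding deriv_span_def funs.dim_span by (simp add: dim_image_eq)
qed

section \<open>Annihilators\<close>

definition annihilator :: "('a::field ^ 'n) set \<Rightarrow> ('a ^ 'n) set" where
  "annihilator W = {v. \<forall>w\<in>W. scalar_product w v = 0}"

lemma subspace_annihilator: "vec.subspace (annihilator W)"
  by (auto simp: annihilator_def vec.subspace_def)

lemma annihilator_span: "annihilator (vec.span W) = annihilator W"
  by (auto simp: annihilator_def vec.span_base intro: scalar_product_span_eq_0)

text \<open>Scalar products with a basis that extends a basis \<open>C\<close> of the span of
  \<open>W\<close> are coordinates on the whole space; on the annihilator those belonging to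
  \<open>C\<close> vanish.\<close>

lemma dim_annihilator_le:
  fixes W :: "('a::field ^ 'n::finite) set"
  shows "vec.dim W + vec.dim (annihilator W) \<le> CARD('n)"
proof -
  obtain C where C: "C \<subseteq> W" "vec.independent C" "card C = vec.dim W"
    using vec.basis_exists by metis
  obtain B where B: "C \<subseteq> B" "vec.independent B" "UNIV \<subseteq> vec.span B"
    using vec.maximal_independent_subset_extend[of C UNIV] C(2) by auto
  have "card B = CARD('n)"
    using vec.basis_card_eq_dim[of B UNIV] B by (simp add: card_cart_basis)
  \<comment> \<open>Indexing the basis by \<open>'n\<close> puts the coordinates of a vector into
    \<open>'a ^ 'n\<close> again, so that \<open>dim_substandard_cart\<close> applies.\<close>
  then obtain h :: "'n \<Rightarrow> 'a ^ 'n" where h: "bij_betw h UNIV B"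
    using finite_same_card_bij[of "UNIV :: 'n set" B] vec.independent_bound_general[OF B(2)] by auto
  define I where "I = {i. h i \<in> C}"
  define f where "f v = (\<chi> i. scalar_product (h i) v)" for v :: "'a ^ 'n"
  have "bij_betw h I C"
    using h B(1) unfolding I_def bij_betw_def by (auto simp: inj_on_def)
  then have card_I: "card I = vec.dim W" using C(3) bij_betw_same_card by metis
  have lin: "Vector_Spaces.linear (*s) (*s) f"
    by unfold_locales (simp_all add: f_def vec_eq_iff)
  have "inj f"
  proof (rule injI)
    fix x y assume "f x = f y"
    then have "scalar_product b (x - y) = 0" if "b \<in> B" for b
      using that bij_betw_imp_surj_on[OF h]
      by (auto simp: f_def vec_eq_iff scalar_product_diff_right)
    then have "scalar_product x w = scalar_product y w" for w
      using scalar_product_span_eq_0[of w B "x - y"] B(3)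
      by (auto simp: scalar_product_diff_right scalar_product_commute[of _ w])
    then show "x = y" by (rule scalar_product_eqI)
  qed
  have "vec.dim (annihilator W) = vec.dim (f ` annihilator W)"
    using vec.dim_image_eq[OF lin, of "annihilator W"] \<open>inj f\<close> by (simp add: inj_on_subset)
  also have "\<dots> \<le> vec.dim {x :: 'a ^ 'n. \<forall>i. i \<notin> - I \<longrightarrow> x $ i = 0}"
    using C(1) by (intro vec.dim_subset) (auto simp: f_def I_def annihilator_def)
  also have "\<dots> = CARD('n) - vec.dim W"
    unfolding dim_substandard_cart by (simp add: Compl_eq_Diff_UNIV card_Diff_subset card_I)
  finally show ?thesis
    using vec.dim_subset_UNIV[of W] by (simp add: vec.dimension_def card_cart_basis)
qed

text \<open>A linear relation among the \<open>h b\<close>, tested against all \<open>q y\<close>,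
  is the same relation among the \<open>b\<close> tested against all \<open>y\<close>, hence
  trivial. So replacing \<open>N\<close> by \<open>N \<circ> p\<close> does not lower the
  dimension.\<close>

lemma span_paired_family_eq:
  fixes N :: "'i \<Rightarrow> 'a::field ^ 'n::finite"
  assumes pair: "\<And>x y. scalar_product (N x) y = scalar_product (N (p x)) (q y)"
  shows "vec.span (range (N \<circ> p)) = vec.span (range N)"
proof -
  obtain B where B: "B \<subseteq> range N" "vec.independent B" "card B = vec.dim (range N)"
    using vec.basis_exists by metis
  have fin: "finite B" using vec.independent_bound_general[OF B(2)] by simp
  obtain s where "\<forall>b\<in>B. b = N (s b)"
    using B(1) bchoice[of B "\<lambda>b x. b = N x"] by auto
  then have s: "\<And>b. b \<in> B \<Longrightarrow> b = N (s b)" by blast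
  define h where "h b = N (p (s b))" for b
  have h: "scalar_product (h b) (q y) = scalar_product b y" if "b \<in> B" for b y
    using pair[of "s b" y] s[OF that] by (simp add: h_def)
  have "inj_on h B"
    by (metis h inj_onI scalar_product_eqI)
  moreover have "vec.independent (h ` B)"
  proof (rule vec.independent_if_scalars_zero)
    fix f x assume 0: "(\<Sum>x\<in>h ` B. f x *s x) = 0" and "x \<in> h ` B"
    then obtain b where b: "b \<in> B" "x = h b" by blast
    have "scalar_product (\<Sum>b\<in>B. f (h b) *s b) y = scalar_product 0 y" for y
    proof -
      have "scalar_product (\<Sum>b\<in>B. f (h b) *s b) y = scalar_product (\<Sum>b\<in>B. f (h b) *s h b) (q y)"
        by (simp add: scalar_product_sum_left h)
      also have "\<dots> = 0"
        using 0 \<open>inj_on h B\<close> by (simp add: sum.reindex)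
      finally show ?thesis by simp
    qed
    then have "(\<Sum>b\<in>B. f (h b) *s b) = 0" by (rule scalar_product_eqI)
    then show "f x = 0"
      using B(2) b unfolding vec.independent_explicit by auto
  qed (use fin in simp)
  moreover have "h ` B \<subseteq> range (N \<circ> p)" by (auto simp: h_def)
  ultimately have "vec.dim (range N) \<le> vec.dim (range (N \<circ> p))"
    using vec.independent_card_le_dim[of "h ` B"] B(3) card_image[of h B] by simp
  moreover have "range (N \<circ> p) \<subseteq> range N" by auto
  ultimately show ?thesis
    by (intro vec.subspace_dim_equal vec.subspace_span vec.span_mono) simp_all
qed

section \<open>Maps preserving the polynomial on all lines\<close>

lemma line_preserving_swap:
  fixes P :: "('n::finite, 'a::field) mpoly"
  assumes hom: "homogeneous P"
    and small: "infinite (UNIV :: 'a set) \<or> mpoly_deg P < card (UNIV :: 'a set)"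
    and pres: "\<And>x y c. mpoly_eval P (x + c *s y) = mpoly_eval P (\<phi> x + c *s \<psi> y)"
  shows "mpoly_eval P (x + c *s y) = mpoly_eval P (\<psi> x + c *s \<phi> y)"
proof -
  obtain d where d: "\<And>m. m \<in> Poly_Mapping.keys P \<Longrightarrow> monom_deg m = d"
    using hom unfolding homogeneous_def by blast
  show ?thesis
  proof (cases "c = 0")
    case True
    \<comment> \<open>For \<open>c = 0\<close> no rescaling is possible; the value at
      \<open>\<psi> x\<close> is read off as the top coefficient along the direction
      \<open>\<psi> x\<close>.\<close>
    have "mpoly_line P 0 x = mpoly_line P (\<phi> 0) (\<psi> x)"
      by (rule mpoly_line_eqI[OF small pres])
    then have "coeff (mpoly_line P 0 x) d = coeff (mpoly_line P (\<phi> 0) (\<psi> x)) d"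
      by simp
    then have "mpoly_eval P x = mpoly_eval P (\<psi> x)"
      by (simp only: coeff_mpoly_line_top[OF d])
    then show ?thesis using True by simp
  next
    case False
    \<comment> \<open>Pulling out \<open>c\<close> exchanges base point and direction, so the given
      identity can be applied at \<open>y\<close>, \<open>x\<close> and
      \<open>inverse c\<close>.\<close>
    then have *: "mpoly_eval P (u + c *s v) = c ^ d * mpoly_eval P (v + inverse c *s u)" for u v
      using mpoly_eval_scale[OF d, where c = c and x = "v + inverse c *s u"]
      by (simp add: vec.scale_right_distrib add.commute)
    show ?thesis unfolding * pres[of y] ..
  qed
qed

text \<open>Derivatives along the radical vanish because the polynomial is constant there; the
  dimension hypothesis leaves no room for a larger annihilator.\<close>

lemma rad_eq_annihilator:
  fixes P :: "('n::finite, 'a::field) mpoly"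
  assumes small: "infinite (UNIV :: 'a set) \<or> mpoly_deg P < card (UNIV :: 'a set)"
    and dims: "funs.dim (deriv_span P) + vec.dim (rad P) = CARD('n)"
  shows "rad P = annihilator (range (grad P))"
proof (rule vec.subspace_dim_equal)
  show "rad P \<subseteq> annihilator (range (grad P))"
  proof
    fix x assume x: "x \<in> rad P"
    have "scalar_product (grad P a) x = 0" for a
    proof -
      have "mpoly_line P a x = mpoly_line P a 0"
        using x by (intro mpoly_line_eqI[OF small]) (simp add: rad_def)
      then show ?thesis by (metis scalar_product_grad scalar_product_linear(6))
    qed
    then show "x \<in> annihilator (range (grad P))" by (simp add: annihilator_def)
  qed
  show "vec.dim (annihilator (range (grad P))) \<le> vec.dim (rad P)"
    using dim_annihilator_le[of "range (grad P)"] dims by (simp add: dim_deriv_span)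
qed (simp_all add: subspace_rad subspace_annihilator)

text \<open>Stated for \<open>p\<close> and \<open>q\<close> so as to serve both for
  \<open>\<phi>\<close>, \<open>\<psi>\<close> and for the exchanged pair.\<close>

lemma mem_rad_grad_imageI:
  fixes P :: "('n::finite, 'a::field) mpoly"
  assumes small: "infinite (UNIV :: 'a set) \<or> mpoly_deg P < card (UNIV :: 'a set)"
    and dims: "funs.dim (deriv_span P) + vec.dim (rad P) = CARD('n)"
    and pres: "\<And>x y c. mpoly_eval P (x + c *s y) = mpoly_eval P (p x + c *s q y)"
    and v: "\<And>x. scalar_product (grad P (p x)) v = 0"
  shows "v \<in> rad P"
proof -
  have "scalar_product (grad P x) y = scalar_product (grad P (p x)) (q y)" for x y
    using mpoly_line_eqI[OF small pres] by (simp add: scalar_product_grad)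
  then have "vec.span (range (grad P \<circ> p)) = vec.span (range (grad P))"
    by (rule span_paired_family_eq)
  moreover have "v \<in> annihilator (range (grad P \<circ> p))" using v by (auto simp: annihilator_def)
  ultimately show ?thesis
    unfolding rad_eq_annihilator[OF small dims] by (metis annihilator_span)
qed

section \<open>Passage to the quotient by the radical\<close>

lemma quot_fun_proj: "quot_fun (rad P) (mpoly_eval P) (quot_proj (rad P) x) = mpoly_eval P x"
  for P :: "('n::finite, 'a::field) mpoly"
  using theI'[OF ex1_quot_fun[of P]] unfolding quot_fun_def[symmetric] by (metis comp_apply)

lemma mpoly_eval_rad_cong:
  assumes "quot_proj (rad P) x = quot_proj (rad P) y"
  shows "mpoly_eval P x = mpoly_eval P y"
  using quot_fun_proj[of P x] quot_fun_proj[of P y] assms by simp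

theorem theorem1p3:
  fixes P :: "('n::finite, 'a::field) mpoly"
    and \<phi> \<psi> :: "'a ^ 'n \<Rightarrow> 'a ^ 'n"
  assumes "homogeneous P"
    and "infinite (UNIV :: 'a set) \<or> mpoly_deg P < card (UNIV :: 'a set)"
    and "funs.dim (deriv_span P) + vec.dim (rad P) = CARD('n)"
    and "\<And>x y c. mpoly_eval P (x + c *s y) = mpoly_eval P (\<phi> x + c *s \<psi> y)"
  shows "\<exists>!T. quot_linear (rad P) T \<and>
      (\<forall>A\<in>quot_carrier (rad P).
         quot_fun (rad P) (mpoly_eval P) (T A) = quot_fun (rad P) (mpoly_eval P) A) \<and>
      quot_proj (rad P) \<circ> \<phi> = quot_proj (rad P) \<circ> \<psi> \<and>
      quot_proj (rad P) \<circ> \<psi> = T \<circ> quot_proj (rad P)"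
proof -
  note small = assms(2) and dims = assms(3) and pres = assms(4)
  have swap: "mpoly_eval P (x + c *s y) = mpoly_eval P (\<psi> x + c *s \<phi> y)" for x y c
    by (rule line_preserving_swap[OF assms(1) small pres])
  let ?\<pi> = "quot_proj (rad P)" and ?Q = "quot_carrier (rad P)"
  note proj_eq_iff = quot_proj_eq_iff[OF subspace_rad[of P]]
    and proj_add = quot_proj_add[OF subspace_rad[of P]]
    and proj_scale = quot_scale_proj[OF subspace_rad[of P]]
  have pair: "scalar_product (grad P (\<phi> x)) (\<psi> y) = scalar_product (grad P x) y" for x y
    using mpoly_line_eqI[OF small pres] by (simp add: scalar_product_grad)
  have pair': "scalar_product (grad P (\<psi> x)) (\<phi> y) = scalar_product (grad P x) y" for x y
    using mpoly_line_eqI[OF small swap] by (simp add: scalar_product_grad)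
  \<comment> \<open>The gradient at \<open>\<phi> z\<close> takes on \<open>\<psi> u\<close> a value
    linear in \<open>u\<close>, so it kills every defect of linearity of
    \<open>\<psi>\<close>.\<close>
  have add: "?\<pi> (\<psi> (x + y)) = ?\<pi> (\<psi> x + \<psi> y)" for x y
    unfolding proj_eq_iff
    by (rule mem_rad_grad_imageI[OF small dims pres]) (simp add: scalar_product_diff_right pair)
  have scale: "?\<pi> (\<psi> (c *s x)) = ?\<pi> (c *s \<psi> x)" for c x
    unfolding proj_eq_iff
    by (rule mem_rad_grad_imageI[OF small dims pres]) (simp add: scalar_product_diff_right pair)
  have inv: "mpoly_eval P (\<psi> x) = mpoly_eval P x" for x
    using swap[of x 0 0] by simp
  have "mpoly_eval P (x + c *s y) = mpoly_eval P (\<psi> x + c *s \<psi> y)" for x y c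
  proof -
    have "?\<pi> (\<psi> (x + c *s y)) = ?\<pi> (\<psi> x + c *s \<psi> y)"
      using add[of x "c *s y"] scale[of c y] proj_add by metis
    then show ?thesis using mpoly_eval_rad_cong inv by metis
  qed
  then have "scalar_product (grad P (\<psi> x)) (\<psi> y) = scalar_product (grad P x) y" for x y
    using mpoly_line_eqI[OF small] by (metis scalar_product_grad)
  \<comment> \<open>The test gradients are now those at the points \<open>\<psi> x\<close>, hence
    \<open>swap\<close> in place of \<open>pres\<close>.\<close>
  then have eq: "?\<pi> (\<phi> y) = ?\<pi> (\<psi> y)" for y
    unfolding proj_eq_iff
    by (intro mem_rad_grad_imageI[OF small dims swap]) (simp add: scalar_product_diff_right pair')
  \<comment> \<open>By \<open>pair\<close>, the gradient at \<open>\<phi> z\<close> takes on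
    \<open>\<psi> x - \<psi> y\<close> the value of the gradient at \<open>z\<close> on
    \<open>x - y\<close>, which lies in the radical.\<close>
  have cong: "?\<pi> (\<psi> x) = ?\<pi> (\<psi> y)" if "?\<pi> x = ?\<pi> y" for x y
    unfolding proj_eq_iff
  proof (rule mem_rad_grad_imageI[OF small dims pres])
    fix z
    have "x - y \<in> annihilator (range (grad P))"
      using that proj_eq_iff rad_eq_annihilator[OF small dims] by blast
    then show "scalar_product (grad P (\<phi> z)) (\<psi> x - \<psi> y) = 0"
      by (auto simp: annihilator_def scalar_product_diff_right pair)
  qed
  \<comment> \<open>By \<open>cong\<close> the chosen representative does not matter;
    \<open>restrict\<close> provides the extensionality demanded by
    \<open>quot_linear\<close>.\<close>
  define T where "T = restrict (\<lambda>A. ?\<pi> (\<psi> (SOME x. ?\<pi> x = A))) ?Q"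
  have T: "T (?\<pi> x) = ?\<pi> (\<psi> x)" for x
  proof -
    have "?\<pi> (SOME y. ?\<pi> y = ?\<pi> x) = ?\<pi> x" by (rule someI) (rule refl)
    from cong[OF this] show ?thesis by (simp add: T_def quot_carrier_def)
  qed
  show ?thesis
  proof (rule ex1I[of _ T], intro conjI)
    show "quot_linear (rad P) T"
      unfolding quot_linear_def
    proof (intro conjI)
      show "T \<in> ?Q \<rightarrow>\<^sub>E ?Q"
        by (auto simp: T_def quot_carrier_def)
    qed (auto simp: quot_carrier_def T proj_add proj_scale add scale)
    show "\<forall>A\<in>?Q. quot_fun (rad P) (mpoly_eval P) (T A) = quot_fun (rad P) (mpoly_eval P) A"
      by (auto simp: quot_carrier_def T quot_fun_proj inv)
    show "?\<pi> \<circ> \<phi> = ?\<pi> \<circ> \<psi>" "?\<pi> \<circ> \<psi> = T \<circ> ?\<pi>"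
      by (simp_all add: fun_eq_iff eq T)
  next
    fix T'
    assume *: "quot_linear (rad P) T' \<and>
      (\<forall>A\<in>?Q. quot_fun (rad P) (mpoly_eval P) (T' A) = quot_fun (rad P) (mpoly_eval P) A) \<and>
      ?\<pi> \<circ> \<phi> = ?\<pi> \<circ> \<psi> \<and> ?\<pi> \<circ> \<psi> = T' \<circ> ?\<pi>"
    \<comment> \<open>Every coset is some \<open>?\<pi> x\<close>, where the value is forced to be
      \<open>?\<pi> (\<psi> x)\<close>; off the quotient extensionality fixes the value.\<close>
    then have "T' \<in> extensional ?Q" by (auto simp: quot_linear_def PiE_def)
    moreover have "T' (?\<pi> x) = T (?\<pi> x)" for x
      using * by (simp add: T fun_eq_iff)
    ultimately show "T' = T"
      by (intro extensionalityI[of _ ?Q]) (auto simp: quot_carrier_def T_def)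
  qed
qed

end
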